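(* Let $n\ge 1$, $p>1$ be integers, $A_0,A_1,\dots,A_n$ real symmetric $p\times p$ matrices, $\mathcal A(x)=A_0+\sum_{i=1}^n x_iA_i$, and suppose $X=\{x\in\mathbb R^n:\mathcal A(x)\in\mathcal{COP}^p\}\neq\emptyset$. Consider a run of the algorithm REG-LCoP (defined in the context) that stops at iteration $\#m_*$ with $m_*>0$, and let $Y_0=\mathbb O_p$ (the null matrix), $\mathcal F_0=\mathcal{COP}^p$, $$Y_1=\sum_{i\in I_1}\gamma(i)\tau(i)\tau(i)^\top,\qquad Y_{m+1}=\sum_{i\in\Delta I_m}\gamma(i)\tau(i)\tau(i)^\top+\sum_{i\in I_m}\big[\tau(i)\lambda^m(i)^\top+\lambda^m(i)\tau(i)^\top\big],\quad 1\le m\le m_*-1,$$ and $\mathcal F_m=\mathcal F_{m-1}\cap\{Y_m\}^\perp$ for $m=1,\dots,m_*$. Then $Y_1\ne\mathbb O_p$ and for every $m=1,\dots,m_*$: (a) $Y_m\in\mathcal F_{m-1}^*$; (b) $Y_m\in\mathrm{Ker}\,\mathcal A$; (c) $\mathcal F_m=\{D\in\mathcal{COP}^p:\ e_k^\top D\tau(i)=0\ \forall k\in L_m(i),\ e_k^\top D\tau(i)\ge 0\ \forall k\in P\setminus L_m(i),\ \forall i\in I_m\}$; (d) $\mathcal F_m^*=\mathrm{cl}\,(\mathcal{CP}^p\oplus\mathcal P_m^* )$, where $\mathcal P_m^*$ is the set of all matrices $\sum_{i\in I_m}[\tau(i)\lambda(i)^\top+\lambda(i)\tau(i)^\top]$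 with $\lambda(i)\in\mathbb R^p$, $\lambda_k(i)\ge 0$ for all $k\in P\setminus L_m(i)$, $i\in I_m$.
   Context: Notation. $\mathcal S(p)$ is the space of real symmetric $p\times p$ matrices with inner product $A\bullet B=\mathrm{trace}(AB)$; $\mathcal{COP}^p=\{D\in\mathcal S(p): t^\top Dt\ge 0\ \forall t\in\mathbb R^p_+\}$; $\mathcal{CP}^p=\mathrm{conv}\{tt^\top:t\in\mathbb R^p_+\}$; $\mathcal F^*=\{U\in\mathcal S(p):U\bullet D\ge 0\ \forall D\in\mathcal F\}$ is the dual cone; $\{Y\}^\perp=\{D\in\mathcal S(p):D\bullet Y=0\}$; $\oplus$ is the Minkowski sum, $\mathrm{cl}$ the closure; $\mathrm{Ker}\,\mathcal A=\{D\in\mathcal S(p):A_j\bullet D=0\ \forall j=0,1,\dots,n\}$. $P=\{1,\dots,p\}$; $e_1,\dots,e_p$ is the standard basis of $\mathbb R^p$; $T=\{t\in\mathbb R^p_+:\sum_{k\in P}t_k=1\}$. For $t\in\mathbb R^p_+$: $P_+(t)=\{k\in P:t_k>0\}$, $P_0(t)=P\setminus P_+(t)$. Index families $(\tau(i))_{i\in I}$ are labelled by finite sets $I$. For a finite nonempty set $V=\{\tau(i):i\in I\}\subset T$ put $\sigma(V)=\min\{\tau_k(i): k\in P_+(\tau(i)),\ i\in I\}>0$ and $\Omega(V)=\{t\in T:\rho(t,\mathrm{conv}\,V)\ge\sigma(V)\}$, where $\rho(l,\mathcal B)=\min_{\tau\in\mathcal B}\sum_{k\in P}|l_k-\tau_k|$.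 Algorithm REG-LCoP. Iteration $\#0$. Consider the problem $(SIP_0)$: minimize $\mu$ over $(x,\mu)\in\mathbb R^{n+1}$ subject to $t^\top\mathcal A(x)t+\mu\ge 0$ for all $t\in T$. If it has a feasible solution with $\mu<0$, stop with $m_*=0$. Otherwise choose a finite nonempty index set $I_1$, $|I_1|\le n+1$, and $\tau(i)\in T$, $\gamma(i)>0$ for $i\in I_1$, such that $\sum_{i\in I_1}\gamma(i)\tau(i)^\top A_j\tau(i)=0$ for $j=0,1,\dots,n$ and $\sum_{i\in I_1}\gamma(i)=1$. Set $L_1(i)=P_+(\tau(i))$, $i\in I_1$, and go to iteration $\#1$. Iteration $\#m$, $m\ge 1$. Given $\tau(i)\in T$ and $L_m(i)\subset P$, $i\in I_m$, set $W_m=\{\tau(i):i\in I_m\}$ and consider the problem $(SIP_m)$: minimize $\mu$ over $(x,\mu)\in\mathbb R^{n+1}$ subject to $e_k^\top\mathcal A(x)\tau(i)=0$ for all $k\in L_m(i)$ and $e_k^\top\mathcal A(x)\tau(i)\ge 0$ for all $k\in P\setminus L_m(i)$, for all $i\in I_m$, and $t^\top\mathcal A(x)t+\mu\ge 0$ for all $t\in\Omega(W_m)$. If it has a feasible solution with $\mu<0$, stop with $m_*=m$. Otherwise choose a finite index set $\Delta I_m$ disjoint from $I_m$ with $1\le|\Delta I_m|\le n+1$, points $\tau(i)\in\Omega(W_m)$ and numbers $\gamma(i)>0$ for $i\in\Delta I_m$, and vectors $\lambda^m(i)\in\mathbb R^p$ for $i\in I_m$, such that $$\sum_{i\in\Delta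 I_m}\gamma(i)\tau(i)^\top A_j\tau(i)+2\sum_{i\in I_m}\lambda^m(i)^\top A_j\tau(i)=0,\quad j=0,1,\dots,n,$$ $\lambda^m_k(i)\ge 0$ for all $k\in P\setminus L_m(i)$, $i\in I_m$, and $P_0(\tau(i))\cap P_+(\tau(j))\neq\emptyset$ for all $i\in\Delta I_m$, $j\in I_m$. Set $\Delta L(i)=\{k\in P\setminus L_m(i):\lambda_k^m(i)>0\}$ and $L_{m+1}(i)=L_m(i)\cup\Delta L(i)$ for $i\in I_m$; $L_{m+1}(i)=P_+(\tau(i))$ for $i\in\Delta I_m$; $I_{m+1}=I_m\cup\Delta I_m$; and go to iteration $\#(m+1)$. *)

theory Defs
  imports "HOL-Analysis.Analysis"
begin

(* The order p of the matrices is CARD('p) and the number n of variables is CARD('n); both are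
   arbitrary. The matrix A_0 is kept apart as A0, and A_1, ..., A_n is the family A indexed by 'n,
   so that "for j = 0, 1, ..., n" is quantification over insert A0 (range A). *)

section \<open>Symmetric matrices and cones\<close>

definition sym_mats :: "(real^'p^'p) set" where
  "sym_mats = {D. transpose D = D}"

definition mat_inner :: "real^'p^'p \<Rightarrow> real^'p^'p \<Rightarrow> real" where
  "mat_inner C D = trace (C ** D)"

definition outer :: "real^'p \<Rightarrow> real^'p \<Rightarrow> real^'p^'p" where
  "outer u v = (\<chi> i j. u $ i * v $ j)"

definition nonneg_vecs :: "(real^'p) set" where
  "nonneg_vecs = {t. \<forall>k. 0 \<le> t $ k}"

definition COP :: "(real^'p^'p) set" where
  "COP = {D \<in> sym_mats. \<forall>t \<in> nonneg_vecs. 0 \<le> t \<bullet> (D *v t)}"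

definition CP :: "(real^'p^'p) set" where
  "CP = convex hull {outer t t | t. t \<in> nonneg_vecs}"

definition dual_cone :: "(real^'p^'p) set \<Rightarrow> (real^'p^'p) set" where
  "dual_cone F = {U \<in> sym_mats. \<forall>D \<in> F. 0 \<le> mat_inner U D}"

definition perp :: "real^'p^'p \<Rightarrow> (real^'p^'p) set" where
  "perp Y = {D \<in> sym_mats. mat_inner D Y = 0}"

definition lin_mat :: "real^'p^'p \<Rightarrow> ('n \<Rightarrow> real^'p^'p) \<Rightarrow> real^('n::finite) \<Rightarrow> real^'p^'p" where
  "lin_mat A0 A x = A0 + (\<Sum>i\<in>UNIV. x $ i *\<^sub>R A i)"

definition Ker_mat :: "real^'p^'p \<Rightarrow> ('n \<Rightarrow> real^'p^'p) \<Rightarrow> (real^'p^'p) set" where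
  "Ker_mat A0 A = {D \<in> sym_mats. \<forall>B \<in> insert A0 (range A). mat_inner B D = 0}"


section \<open>The simplex\<close>

definition simplex_T :: "(real^'p) set" where
  "simplex_T = {t \<in> nonneg_vecs. (\<Sum>k\<in>UNIV. t $ k) = 1}"

definition P_pos :: "real^'p \<Rightarrow> 'p set" where
  "P_pos t = {k. 0 < t $ k}"

definition P_zero :: "real^'p \<Rightarrow> 'p set" where
  "P_zero t = - P_pos t"

(* Only used for B the convex hull of a finite nonempty set, which is compact, so that the
   infimum is a minimum. *)
definition rho :: "real^'p \<Rightarrow> (real^'p) set \<Rightarrow> real" where
  "rho l B = (INF \<tau>\<in>B. \<Sum>k\<in>UNIV. \<bar>l $ k - \<tau> $ k\<bar>)"

definition sigma :: "(real^'p) set \<Rightarrow> real" where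
  "sigma V = Min {\<tau> $ k | \<tau> k. \<tau> \<in> V \<and> k \<in> P_pos \<tau>}"

definition Omega :: "(real^'p) set \<Rightarrow> (real^'p) set" where
  "Omega V = {t \<in> simplex_T. sigma V \<le> rho t (convex hull V)}"


section \<open>The algorithm REG-LCoP\<close>

definition SIP0_feasible ::
  "real^'p^'p \<Rightarrow> ('n::finite \<Rightarrow> real^'p^'p) \<Rightarrow> ((real^'n) \<times> real) set" where
  "SIP0_feasible A0 A = {(x, \<mu>). \<forall>t \<in> simplex_T. 0 \<le> t \<bullet> (lin_mat A0 A x *v t) + \<mu>}"

definition SIP_feasible ::
  "real^'p^'p \<Rightarrow> ('n::finite \<Rightarrow> real^'p^'p) \<Rightarrow> 'i set \<Rightarrow> ('i \<Rightarrow> real^'p) \<Rightarrow> ('i \<Rightarrow> 'p set)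
    \<Rightarrow> ((real^'n) \<times> real) set" where
  "SIP_feasible A0 A I \<tau> L = {(x, \<mu>).
     (\<forall>i\<in>I. (\<forall>k\<in>L i. axis k 1 \<bullet> (lin_mat A0 A x *v \<tau> i) = 0) \<and>
            (\<forall>k\<in>- L i. 0 \<le> axis k 1 \<bullet> (lin_mat A0 A x *v \<tau> i))) \<and>
     (\<forall>t \<in> Omega (\<tau> ` I). 0 \<le> t \<bullet> (lin_mat A0 A x *v t) + \<mu>)}"

definition SIP_region ::
  "real^'p^'p \<Rightarrow> ('n::finite \<Rightarrow> real^'p^'p) \<Rightarrow> (nat \<Rightarrow> 'i set) \<Rightarrow> ('i \<Rightarrow> real^'p)
    \<Rightarrow> (nat \<Rightarrow> 'i \<Rightarrow> 'p set) \<Rightarrow> nat \<Rightarrow> ((real^'n) \<times> real) set" where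
  "SIP_region A0 A I \<tau> L m =
     (if m = 0 then SIP0_feasible A0 A else SIP_feasible A0 A (I m) \<tau> (L m))"

definition stop_test ::
  "real^'p^'p \<Rightarrow> ('n::finite \<Rightarrow> real^'p^'p) \<Rightarrow> (nat \<Rightarrow> 'i set) \<Rightarrow> ('i \<Rightarrow> real^'p)
    \<Rightarrow> (nat \<Rightarrow> 'i \<Rightarrow> 'p set) \<Rightarrow> nat \<Rightarrow> bool" where
  "stop_test A0 A I \<tau> L m \<longleftrightarrow> (\<exists>x \<mu>. (x, \<mu>) \<in> SIP_region A0 A I \<tau> L m \<and> \<mu> < 0)"

definition initial_step ::
  "real^'p^'p \<Rightarrow> ('n::finite \<Rightarrow> real^'p^'p) \<Rightarrow> 'i set \<Rightarrow> ('i \<Rightarrow> real^'p) \<Rightarrow> ('i \<Rightarrow> real)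
    \<Rightarrow> ('i \<Rightarrow> 'p set) \<Rightarrow> bool" where
  "initial_step A0 A I1 \<tau> \<gamma> L1 \<longleftrightarrow>
     finite I1 \<and> I1 \<noteq> {} \<and> card I1 \<le> CARD('n) + 1 \<and>
     (\<forall>i\<in>I1. \<tau> i \<in> simplex_T \<and> 0 < \<gamma> i) \<and>
     (\<forall>B \<in> insert A0 (range A). (\<Sum>i\<in>I1. \<gamma> i * (\<tau> i \<bullet> (B *v \<tau> i))) = 0) \<and>
     (\<Sum>i\<in>I1. \<gamma> i) = 1 \<and>
     (\<forall>i\<in>I1. L1 i = P_pos (\<tau> i))"

(* I, L: current data; dI, lam: the choice made in this iteration; I', L': data passed on. *)
definition iteration_step ::
  "real^'p^'p \<Rightarrow> ('n::finite \<Rightarrow> real^'p^'p) \<Rightarrow> ('i \<Rightarrow> real^'p) \<Rightarrow> ('i \<Rightarrow> real)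
    \<Rightarrow> 'i set \<Rightarrow> ('i \<Rightarrow> 'p set) \<Rightarrow> 'i set \<Rightarrow> ('i \<Rightarrow> real^'p)
    \<Rightarrow> 'i set \<Rightarrow> ('i \<Rightarrow> 'p set) \<Rightarrow> bool" where
  "iteration_step A0 A \<tau> \<gamma> I L dI lam I' L' \<longleftrightarrow>
     finite dI \<and> dI \<inter> I = {} \<and> 1 \<le> card dI \<and> card dI \<le> CARD('n) + 1 \<and>
     (\<forall>i\<in>dI. \<tau> i \<in> Omega (\<tau> ` I) \<and> 0 < \<gamma> i) \<and>
     (\<forall>B \<in> insert A0 (range A).
        (\<Sum>i\<in>dI. \<gamma> i * (\<tau> i \<bullet> (B *v \<tau> i))) + 2 * (\<Sum>i\<in>I. lam i \<bullet> (B *v \<tau> i)) = 0) \<and>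
     (\<forall>i\<in>I. \<forall>k\<in>- L i. 0 \<le> lam i $ k) \<and>
     (\<forall>i\<in>dI. \<forall>j\<in>I. P_zero (\<tau> i) \<inter> P_pos (\<tau> j) \<noteq> {}) \<and>
     (\<forall>i\<in>I. L' i = L i \<union> {k \<in> - L i. 0 < lam i $ k}) \<and>
     (\<forall>i\<in>dI. L' i = P_pos (\<tau> i)) \<and>
     I' = I \<union> dI"

(* A run that stops at iteration ms. As the index sets dI m are disjoint from I m, one family
   \<tau> and one family \<gamma> serve for all iterations. *)
definition REG_LCoP_run ::
  "real^'p^'p \<Rightarrow> ('n::finite \<Rightarrow> real^'p^'p) \<Rightarrow> nat \<Rightarrow> (nat \<Rightarrow> 'i set) \<Rightarrow> (nat \<Rightarrow> 'i set)
    \<Rightarrow> ('i \<Rightarrow> real^'p) \<Rightarrow> ('i \<Rightarrow> real) \<Rightarrow> (nat \<Rightarrow> 'i \<Rightarrow> real^'p) \<Rightarrow> (nat \<Rightarrow> 'i \<Rightarrow> 'p set) \<Rightarrow> bool" where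
  "REG_LCoP_run A0 A ms I dI \<tau> \<gamma> lam L \<longleftrightarrow>
     (\<forall>m<ms. \<not> stop_test A0 A I \<tau> L m) \<and> stop_test A0 A I \<tau> L ms \<and>
     (0 < ms \<longrightarrow> initial_step A0 A (I 1) \<tau> \<gamma> (L 1)) \<and>
     (\<forall>m. 1 \<le> m \<and> m < ms \<longrightarrow>
        iteration_step A0 A \<tau> \<gamma> (I m) (L m) (dI m) (lam m) (I (m + 1)) (L (m + 1)))"


section \<open>The matrices and faces generated by a run\<close>

fun Y_mat ::
  "(nat \<Rightarrow> 'i set) \<Rightarrow> (nat \<Rightarrow> 'i set) \<Rightarrow> ('i \<Rightarrow> real^'p) \<Rightarrow> ('i \<Rightarrow> real)
    \<Rightarrow> (nat \<Rightarrow> 'i \<Rightarrow> real^'p) \<Rightarrow> nat \<Rightarrow> real^'p^'p" where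
  "Y_mat I dI \<tau> \<gamma> lam 0 = 0"
| "Y_mat I dI \<tau> \<gamma> lam (Suc 0) = (\<Sum>i\<in>I 1. \<gamma> i *\<^sub>R outer (\<tau> i) (\<tau> i))"
| "Y_mat I dI \<tau> \<gamma> lam (Suc (Suc m)) =
     (\<Sum>i\<in>dI (Suc m). \<gamma> i *\<^sub>R outer (\<tau> i) (\<tau> i)) +
     (\<Sum>i\<in>I (Suc m). outer (\<tau> i) (lam (Suc m) i) + outer (lam (Suc m) i) (\<tau> i))"

primrec face_seq :: "(nat \<Rightarrow> real^'p^'p) \<Rightarrow> nat \<Rightarrow> (real^'p^'p) set" where
  "face_seq Y 0 = COP"
| "face_seq Y (Suc m) = face_seq Y m \<inter> perp (Y (Suc m))"

definition P_star :: "'i set \<Rightarrow> ('i \<Rightarrow> real^'p) \<Rightarrow> ('i \<Rightarrow> 'p set) \<Rightarrow> (real^'p^'p) set" where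
  "P_star I \<tau> L = {\<Sum>i\<in>I. outer (\<tau> i) (lam i) + outer (lam i) (\<tau> i) | lam.
     \<forall>i\<in>I. \<forall>k\<in>- L i. 0 \<le> lam i $ k}"

end

theory Submission
  imports Defs
begin

text \<open>If D is copositive and t is a nonnegative zero of its quadratic form, then D t is
  nonnegative and vanishes on the support of t. Hence the orthogonality conditions that cut out
  the faces are equivalent to sign conditions on the vectors D \<tau>(i): every summand of
  the inner product of D with Y is nonnegative, so the sum vanishes iff all summands do. These sign
  conditions in turn say that D lies in the dual of CP plus the cone P*, and the description of the
  dual face is the bipolar theorem.\<close>

section \<open>Symmetric matrices and the trace inner product\<close>

lemma symmetric_entries: "D \<in> sym_mats \<Longrightarrow> D $ i $ j = D $ j $ i"
  unfolding sym_mats_def by (metis (mono_tags) mem_Collect_eq transpose_def vec_lambda_beta)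

lemma in_sym_matsI: "(\<And>i j. D $ i $ j = D $ j $ i) \<Longrightarrow> D \<in> sym_mats"
  unfolding sym_mats_def by (simp add: vec_eq_iff transpose_def)

text \<open>Symmetry of \<open>C\<close> turns the trace of the product into the entrywise sum,
  which is the Euclidean inner product of the type \<open>real^'p^'p\<close>. Separation and
  half-space arguments can then be used for the trace form.\<close>

lemma mat_inner_eq_inner:
  assumes "C \<in> sym_mats"
  shows "mat_inner C D = C \<bullet> D"
proof -
  have "mat_inner C D = (\<Sum>i\<in>UNIV. \<Sum>j\<in>UNIV. C $ j $ i * D $ j $ i)"
    unfolding mat_inner_def trace_def matrix_matrix_mult_def
    by (simp add: symmetric_entries[OF assms])
  also have "\<dots> = C \<bullet> D"
    by (subst sum.swap) (simp add: inner_vec_def)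
  finally show ?thesis .
qed

lemma subspace_sym_mats: "subspace sym_mats"
  unfolding subspace_def
  by (intro conjI ballI allI in_sym_matsI) (simp_all add: symmetric_entries)

lemma closed_sym_mats: "closed (sym_mats :: (real^'p^'p) set)"
  by (rule closed_subspace[OF subspace_sym_mats])

lemma outer_self_sym: "outer t t \<in> sym_mats"
  by (rule in_sym_matsI) (simp add: outer_def)

lemma outer_pair_sym: "outer u v + outer v u \<in> sym_mats"
  by (rule in_sym_matsI) (simp add: outer_def)

lemma inner_outer: "D \<bullet> outer u v = u \<bullet> (D *v v)"
  by (simp add: inner_vec_def outer_def matrix_vector_mult_def sum_distrib_left mult_ac)

lemma symmetric_inner_swap:
  assumes "D \<in> sym_mats"
  shows "u \<bullet> (D *v v) = v \<bullet> (D *v u)"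
  using assms by (metis (mono_tags) dot_lmul_matrix inner_commute mem_Collect_eq sym_mats_def
      transpose_matrix_vector)

lemma inner_outer_pair:
  assumes "D \<in> sym_mats"
  shows "D \<bullet> (outer u v + outer v u) = 2 * (v \<bullet> (D *v u))"
  using symmetric_inner_swap[OF assms, of u v] by (simp add: inner_add_right inner_outer)

text \<open>The right-hand side is the expression that an iteration sets to zero for each constraint
  matrix. The same formula thus serves for membership in the kernel and for orthogonality to
  matrices of a face.\<close>

lemma inner_outer_sum:
  assumes "D \<in> sym_mats"
  shows "D \<bullet> ((\<Sum>i\<in>J. \<gamma> i *\<^sub>R outer (\<tau> i) (\<tau> i))
      + (\<Sum>i\<in>I. outer (\<tau> i) (lam i) + outer (lam i) (\<tau> i))) =
    (\<Sum>i\<in>J. \<gamma> i * (\<tau> i \<bullet> (D *v \<tau> i))) + 2 * (\<Sum>i\<in>I. lam i \<bullet> (D *v \<tau> i))"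
  by (simp only: inner_add_right[of D "sum _ J"] inner_sum_right inner_scaleR_right inner_outer
      inner_outer_pair[OF assms] sum_distrib_left)

lemma sym_outer_sum:
  "(\<Sum>i\<in>J. \<gamma> i *\<^sub>R outer (\<tau> i) (\<tau> i))
      + (\<Sum>i\<in>I. outer (\<tau> i) (lam i) + outer (lam i) (\<tau> i)) \<in> sym_mats"
  by (intro subspace_add[OF subspace_sym_mats] subspace_sum[OF subspace_sym_mats]
      subspace_scale[OF subspace_sym_mats] outer_self_sym outer_pair_sym)

section \<open>Zeros of copositive forms\<close>

text \<open>First-order optimality: \<open>t\<close> minimizes the form over the orthant. A negative
  component \<open>k\<close> of \<open>D *v t\<close> would make a small step from \<open>t\<close>
  along the \<open>k\<close>-th unit vector a descent step, and the form would become
  negative.\<close>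

lemma copositive_zero_nonneg:
  assumes D: "D \<in> COP" and t: "t \<in> nonneg_vecs" and z: "t \<bullet> (D *v t) = 0"
  shows "0 \<le> (D *v t) $ k"
proof (rule ccontr)
  let ?e = "axis k 1 :: real^'a"
  \<comment> \<open>Along the step the form equals
    \<open>\<epsilon> * (\<epsilon> * d - 2 * c)\<close>. The chosen step length gives
    \<open>\<epsilon> * d \<le> c\<close>, so this is negative; the added 1 keeps the denominator
    positive when \<open>d\<close> is zero.\<close>
  define c d \<epsilon> where "c = - (D *v t) $ k" and "d = ?e \<bullet> (D *v ?e)" and "\<epsilon> = c / (d + 1)"
  have nn: "\<And>u. u \<in> nonneg_vecs \<Longrightarrow> 0 \<le> u \<bullet> (D *v u)" and sym: "D \<in> sym_mats"
    using D by (auto simp: COP_def)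
  assume "\<not> 0 \<le> (D *v t) $ k"
  then have c: "c > 0" by (simp add: c_def)
  have d: "d \<ge> 0" unfolding d_def by (rule nn) (simp add: nonneg_vecs_def axis_def)
  have e: "\<epsilon> > 0" using c d by (simp add: \<epsilon>_def)
  have "0 \<le> (t + \<epsilon> *\<^sub>R ?e) \<bullet> (D *v (t + \<epsilon> *\<^sub>R ?e))"
    using t e by (intro nn) (simp add: nonneg_vecs_def axis_def)
  also have "\<dots> = 2 * \<epsilon> * (?e \<bullet> (D *v t)) + \<epsilon> * (\<epsilon> * d)"
    using symmetric_inner_swap[OF sym, of t ?e] z
    by (simp add: inner_add_left inner_add_right matrix_vector_right_distrib
        matrix_vector_mult_scaleR d_def algebra_simps)
  also have "?e \<bullet> (D *v t) = - c" by (simp add: c_def inner_axis')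
  also have "2 * \<epsilon> * (- c) + \<epsilon> * (\<epsilon> * d) = \<epsilon> * (\<epsilon> * d - 2 * c)"
    by (simp add: algebra_simps)
  finally have "2 * c \<le> \<epsilon> * d" using e by (simp add: zero_le_mult_iff)
  moreover have "\<epsilon> * d \<le> c" using c d by (simp add: \<epsilon>_def field_simps)
  ultimately show False using c by simp
qed

text \<open>Complementarity: the form at \<open>t\<close> is the sum of the products of the
  components of \<open>t\<close> and \<open>D *v t\<close>. At a zero all of them are nonnegative,
  so each vanishes, which forces \<open>D *v t\<close> to be zero on the support of
  \<open>t\<close>.\<close>

lemma copositive_zero_iff:
  assumes D: "D \<in> COP" and t: "t \<in> nonneg_vecs"
  shows "t \<bullet> (D *v t) = 0 \<longleftrightarrow>
    (\<forall>k\<in>P_pos t. (D *v t) $ k = 0) \<and> (\<forall>k\<in>- P_pos t. 0 \<le> (D *v t) $ k)"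
proof
  assume z: "t \<bullet> (D *v t) = 0"
  have nn: "0 \<le> (D *v t) $ k" for k by (rule copositive_zero_nonneg[OF D t z])
  have "\<forall>k\<in>UNIV. t $ k * (D *v t) $ k = 0"
    using z nn t unfolding inner_vec_def
    by (subst (asm) sum_nonneg_eq_0_iff) (auto simp: nonneg_vecs_def)
  then have "(D *v t) $ k = 0" if "0 < t $ k" for k using that by force
  with nn show "(\<forall>k\<in>P_pos t. (D *v t) $ k = 0) \<and> (\<forall>k\<in>- P_pos t. 0 \<le> (D *v t) $ k)"
    by (simp add: P_pos_def)
next
  assume "(\<forall>k\<in>P_pos t. (D *v t) $ k = 0) \<and> (\<forall>k\<in>- P_pos t. 0 \<le> (D *v t) $ k)"
  then have "t $ k * (D *v t) $ k = 0" for k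
    using t by (cases "k \<in> P_pos t") (auto simp: P_pos_def nonneg_vecs_def order.order_iff_strict)
  then show "t \<bullet> (D *v t) = 0" unfolding inner_vec_def by (intro sum.neutral) auto
qed

text \<open>Handles the points chosen in one iteration: their weighted form values are all
  nonnegative, so they cannot cancel.\<close>

lemma weighted_copositive_sum:
  assumes D: "D \<in> COP" and J: "finite J" "\<forall>i\<in>J. \<tau> i \<in> nonneg_vecs \<and> 0 < \<gamma> i"
  shows "0 \<le> (\<Sum>i\<in>J. \<gamma> i * (\<tau> i \<bullet> (D *v \<tau> i)))"
    and "(\<Sum>i\<in>J. \<gamma> i * (\<tau> i \<bullet> (D *v \<tau> i))) = 0 \<longleftrightarrow>
      (\<forall>i\<in>J. (\<forall>k\<in>P_pos (\<tau> i). (D *v \<tau> i) $ k = 0) \<and>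
             (\<forall>k\<in>- P_pos (\<tau> i). 0 \<le> (D *v \<tau> i) $ k))"
proof -
  have nn: "\<And>i. i \<in> J \<Longrightarrow> 0 \<le> \<gamma> i * (\<tau> i \<bullet> (D *v \<tau> i))"
    using D J by (intro mult_nonneg_nonneg) (auto simp: COP_def order.strict_implies_order)
  then show "0 \<le> (\<Sum>i\<in>J. \<gamma> i * (\<tau> i \<bullet> (D *v \<tau> i)))" by (rule sum_nonneg)
  have "(\<Sum>i\<in>J. \<gamma> i * (\<tau> i \<bullet> (D *v \<tau> i))) = 0 \<longleftrightarrow> (\<forall>i\<in>J. \<tau> i \<bullet> (D *v \<tau> i) = 0)"
    using J by (subst sum_nonneg_eq_0_iff[OF J(1) nn]) force+
  then show "(\<Sum>i\<in>J. \<gamma> i * (\<tau> i \<bullet> (D *v \<tau> i))) = 0 \<longleftrightarrow>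
      (\<forall>i\<in>J. (\<forall>k\<in>P_pos (\<tau> i). (D *v \<tau> i) $ k = 0) \<and>
             (\<forall>k\<in>- P_pos (\<tau> i). 0 \<le> (D *v \<tau> i) $ k))"
    using copositive_zero_iff[OF D] J(2) by auto
qed

section \<open>Sign conditions and multipliers\<close>

text \<open>The set claimed in part (c), with the products with unit vectors written as
  components.\<close>

definition face_by_signs :: "'i set \<Rightarrow> ('i \<Rightarrow> real^'p) \<Rightarrow> ('i \<Rightarrow> 'p set) \<Rightarrow> (real^'p^'p) set" where
  "face_by_signs I \<tau> L = {D \<in> COP. \<forall>i\<in>I.
     (\<forall>k\<in>L i. (D *v \<tau> i) $ k = 0) \<and> (\<forall>k\<in>- L i. 0 \<le> (D *v \<tau> i) $ k)}"

lemma sign_terms_nonneg: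
  assumes "D \<in> face_by_signs I \<tau> L" "\<forall>i\<in>I. \<forall>k\<in>- L i. 0 \<le> lam i $ k" "i \<in> I"
  shows "0 \<le> lam i $ k * (D *v \<tau> i) $ k"
  using assms by (cases "k \<in> L i") (auto simp: face_by_signs_def)

text \<open>On \<open>L i\<close> a multiplier has any sign but meets a zero of
  \<open>D *v \<tau> i\<close>; off \<open>L i\<close> both factors are nonnegative. Hence the sum
  vanishes only term by term, and the indices where this is a new condition are those that the
  algorithm adds to \<open>L i\<close>.\<close>

lemma multiplier_sum:
  assumes D: "D \<in> face_by_signs I \<tau> L" and lam: "\<forall>i\<in>I. \<forall>k\<in>- L i. 0 \<le> lam i $ k"
    and I: "finite I"
  shows "0 \<le> (\<Sum>i\<in>I. lam i \<bullet> (D *v \<tau> i))"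
    and "(\<Sum>i\<in>I. lam i \<bullet> (D *v \<tau> i)) = 0 \<longleftrightarrow>
      (\<forall>i\<in>I. \<forall>k\<in>- L i. 0 < lam i $ k \<longrightarrow> (D *v \<tau> i) $ k = 0)"
proof -
  note nn = sign_terms_nonneg[OF D lam]
  have inner_nn: "0 \<le> lam i \<bullet> (D *v \<tau> i)" if "i \<in> I" for i
    using nn[OF that] by (auto simp: inner_vec_def intro: sum_nonneg)
  then show "0 \<le> (\<Sum>i\<in>I. lam i \<bullet> (D *v \<tau> i))" by (rule sum_nonneg)
  have term_zero: "lam i $ k * (D *v \<tau> i) $ k = 0 \<longleftrightarrow>
      (k \<in> - L i \<longrightarrow> 0 < lam i $ k \<longrightarrow> (D *v \<tau> i) $ k = 0)" if "i \<in> I" for i k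
    using D lam that by (cases "k \<in> L i") (auto simp: face_by_signs_def order.order_iff_strict)
  have "lam i \<bullet> (D *v \<tau> i) = 0 \<longleftrightarrow> (\<forall>k\<in>- L i. 0 < lam i $ k \<longrightarrow> (D *v \<tau> i) $ k = 0)"
    if "i \<in> I" for i
  proof -
    have "lam i \<bullet> (D *v \<tau> i) = 0 \<longleftrightarrow> (\<forall>k. lam i $ k * (D *v \<tau> i) $ k = 0)"
      using nn[OF that] by (simp add: inner_vec_def sum_nonneg_eq_0_iff)
    then show ?thesis using term_zero[OF that] by auto
  qed
  then show "(\<Sum>i\<in>I. lam i \<bullet> (D *v \<tau> i)) = 0 \<longleftrightarrow>
      (\<forall>i\<in>I. \<forall>k\<in>- L i. 0 < lam i $ k \<longrightarrow> (D *v \<tau> i) $ k = 0)"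
    by (simp add: sum_nonneg_eq_0_iff[OF I inner_nn])
qed

section \<open>Dual cones and the bipolar theorem\<close>

lemma dual_cone_eq: "dual_cone K = {U \<in> sym_mats. \<forall>D\<in>K. 0 \<le> U \<bullet> D}"
  by (auto simp: dual_cone_def mat_inner_eq_inner)

lemma closed_dual_cone: "closed (dual_cone (K :: (real^'p^'p) set))"
proof -
  have "dual_cone K = sym_mats \<inter> (\<Inter>D\<in>K. {U. D \<bullet> U \<ge> 0})"
    by (auto simp: dual_cone_eq inner_commute)
  then show ?thesis
    by (auto intro!: closed_Int closed_INT closed_sym_mats closed_halfspace_ge)
qed

text \<open>The bipolar theorem relative to the subspace of symmetric matrices. Separation takes
  place in the space of all matrices, so the separating normal has to be symmetrized before it can
  belong to the dual cone.\<close>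

lemma bidual_cone:
  fixes K :: "(real^'p^'p) set"
  assumes sym: "K \<subseteq> sym_mats" and conv: "convex K" and cone: "cone K" and zero: "0 \<in> K"
  shows "dual_cone (dual_cone K) = closure K"
proof
  show "closure K \<subseteq> dual_cone (dual_cone K)"
    using sym by (intro closure_minimal closed_dual_cone) (auto simp: dual_cone_eq inner_commute)
  show "dual_cone (dual_cone K) \<subseteq> closure K"
  proof
    fix U assume U: "U \<in> dual_cone (dual_cone K)"
    show "U \<in> closure K"
    proof (rule ccontr)
      assume "U \<notin> closure K"
      then obtain a b where ab: "a \<bullet> U < b" "\<forall>x\<in>closure K. a \<bullet> x > b"
        using separating_hyperplane_closed_point[of "closure K" U] conv
        by (auto simp: convex_closure)
      have b: "b < 0" using ab(2) zero closure_subset[of K] by force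
      have ge: "a \<bullet> x \<ge> 0" if "x \<in> K" for x
      proof (rule ccontr)
        assume neg: "\<not> a \<bullet> x \<ge> 0"
        \<comment> \<open>Both \<open>b\<close> and \<open>a \<bullet> x\<close> are negative, so
          the factor is positive. The scaled point stays in the cone but lies on the separating
          hyperplane, which contradicts strict separation.\<close>
        then have "(b / (a \<bullet> x)) *\<^sub>R x \<in> K"
          using b that by (intro mem_cone[OF cone]) (auto simp: divide_nonpos_neg)
        then have "a \<bullet> ((b / (a \<bullet> x)) *\<^sub>R x) > b" using ab(2) closure_subset[of K] by blast
        then show False using neg by simp
      qed
      \<comment> \<open>Against symmetric matrices the symmetrized normal acts as twice
        \<open>a\<close>, so the separation survives.\<close>
      have tr: "(a + transpose a) \<bullet> x = 2 * (a \<bullet> x)" if "x \<in> sym_mats" for x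
      proof -
        have "transpose a \<bullet> x = (\<Sum>i\<in>UNIV. \<Sum>j\<in>UNIV. a $ j $ i * x $ j $ i)"
          by (simp add: inner_vec_def transpose_def symmetric_entries[OF that])
        also have "\<dots> = a \<bullet> x" by (subst sum.swap) (simp add: inner_vec_def)
        finally show ?thesis by (simp add: inner_add_left)
      qed
      have "a + transpose a \<in> dual_cone K"
        using ge tr sym by (auto simp: dual_cone_eq transpose_def intro!: in_sym_matsI)
      then have "0 \<le> U \<bullet> (a + transpose a)" using U by (auto simp: dual_cone_eq)
      moreover have "U \<in> sym_mats" using U by (simp add: dual_cone_eq)
      ultimately show False using tr ab(1) b by (simp add: inner_commute)
    qed
  qed
qed

section \<open>The completely positive cone\<close>

lemma CP_sym: "CP \<subseteq> sym_mats"
  unfolding CP_def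
  by (rule hull_minimal) (auto simp: outer_self_sym subspace_imp_convex subspace_sym_mats)

lemma cone_CP: "cone (CP :: (real^'p^'p) set)"
proof -
  have "cone {outer t t | t :: real^'p. t \<in> nonneg_vecs}"
  proof (unfold cone_def, safe)
    fix t :: "real^'p" and c :: real
    assume "t \<in> nonneg_vecs" "c \<ge> 0"
    then have "c *\<^sub>R outer t t = outer (sqrt c *\<^sub>R t) (sqrt c *\<^sub>R t)" "sqrt c *\<^sub>R t \<in> nonneg_vecs"
      by (auto simp: outer_def vec_eq_iff nonneg_vecs_def)
    then show "\<exists>s. c *\<^sub>R outer t t = outer s s \<and> s \<in> nonneg_vecs" by blast
  qed
  then show ?thesis unfolding CP_def by (rule cone_convex_hull)
qed

lemma zero_in_CP: "0 \<in> CP"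
  unfolding CP_def
  by (rule hull_inc) (auto simp: outer_def vec_eq_iff nonneg_vecs_def intro!: exI[of _ 0])

text \<open>A linear inequality holds on a convex hull as soon as it holds on the generators, and on
  \<open>outer t t\<close> it reads as nonnegativity of the form at \<open>t\<close>.\<close>

lemma dual_cone_CP: "dual_cone CP = (COP :: (real^'p^'p) set)"
proof -
  have "(\<forall>U\<in>CP. 0 \<le> D \<bullet> U) \<longleftrightarrow> (\<forall>t\<in>nonneg_vecs. 0 \<le> t \<bullet> (D *v t))" for D :: "real^'p^'p"
  proof
    assume D: "\<forall>U\<in>CP. 0 \<le> D \<bullet> U"
    have "outer t t \<in> CP" if "t \<in> nonneg_vecs" for t :: "real^'p"
      unfolding CP_def using that by (intro hull_inc) blast
    with D show "\<forall>t\<in>nonneg_vecs. 0 \<le> t \<bullet> (D *v t)"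
      by (metis inner_outer)
  next
    assume "\<forall>t\<in>nonneg_vecs. 0 \<le> t \<bullet> (D *v t)"
    then have "CP \<subseteq> {U. D \<bullet> U \<ge> 0}"
      unfolding CP_def by (intro hull_minimal convex_halfspace_ge) (auto simp: inner_outer)
    then show "\<forall>U\<in>CP. 0 \<le> D \<bullet> U" by auto
  qed
  then show ?thesis by (simp add: dual_cone_eq COP_def)
qed

section \<open>The cone of multiplier matrices\<close>

lemma P_star_sym: "P_star I \<tau> L \<subseteq> sym_mats"
  unfolding P_star_def
  by (auto intro!: subspace_sum[OF subspace_sym_mats] outer_pair_sym)

lemma outer_add_left: "outer (u + v) w = outer u w + outer v w"
  and outer_add_right: "outer w (u + v) = outer w u + outer w v"
  and outer_scale_left: "outer (c *\<^sub>R u) w = c *\<^sub>R outer u w"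
  and outer_scale_right: "outer w (c *\<^sub>R u) = c *\<^sub>R outer w u"
  by (simp_all add: outer_def vec_eq_iff algebra_simps)

lemma cone_P_star: "cone (P_star I \<tau> L)"
proof (unfold cone_def, safe)
  fix U and c :: real
  assume "U \<in> P_star I \<tau> L" "c \<ge> 0"
  then obtain l where "U = (\<Sum>i\<in>I. outer (\<tau> i) (l i) + outer (l i) (\<tau> i))"
    "\<forall>i\<in>I. \<forall>k\<in>- L i. 0 \<le> l i $ k" by (auto simp: P_star_def)
  with \<open>c \<ge> 0\<close> show "c *\<^sub>R U \<in> P_star I \<tau> L"
    unfolding P_star_def
    by (auto simp: scaleR_sum_right scaleR_add_right outer_scale_left outer_scale_right
        intro!: exI[of _ "\<lambda>i. c *\<^sub>R l i"])
qed

lemma P_star_add: "U \<in> P_star I \<tau> L \<Longrightarrow> V \<in> P_star I \<tau> L \<Longrightarrow> U + V \<in> P_star I \<tau> L"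
proof -
  assume "U \<in> P_star I \<tau> L" "V \<in> P_star I \<tau> L"
  then obtain l l' where "U = (\<Sum>i\<in>I. outer (\<tau> i) (l i) + outer (l i) (\<tau> i))"
    "V = (\<Sum>i\<in>I. outer (\<tau> i) (l' i) + outer (l' i) (\<tau> i))"
    "\<forall>i\<in>I. \<forall>k\<in>- L i. 0 \<le> l i $ k" "\<forall>i\<in>I. \<forall>k\<in>- L i. 0 \<le> l' i $ k"
    unfolding P_star_def by blast
  then show ?thesis
    unfolding P_star_def
    by (auto simp: outer_add_left outer_add_right sum.distrib add_ac
        intro!: exI[of _ "\<lambda>i. l i + l' i"])
qed

lemma zero_in_P_star: "0 \<in> P_star I \<tau> L"
  unfolding P_star_def by (auto simp: outer_def vec_eq_iff intro!: exI[of _ "\<lambda>_. 0"])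

lemma convex_P_star: "convex (P_star I \<tau> L)"
  by (intro convexI P_star_add mem_cone[OF cone_P_star])

section \<open>Faces as dual cones\<close>

text \<open>The summand \<open>CP\<close> encodes copositivity and \<open>P_star\<close> encodes the
  sign conditions. Both cones contain zero, so a functional that is nonnegative on the sum is
  nonnegative on each of them.\<close>

lemma face_by_signs_eq_dual:
  assumes I: "finite I"
  shows "face_by_signs I \<tau> L = dual_cone (CP + P_star I \<tau> L)"
proof
  show "face_by_signs I \<tau> L \<subseteq> dual_cone (CP + P_star I \<tau> L)"
  proof
    fix D assume D: "D \<in> face_by_signs I \<tau> L"
    then have COP: "D \<in> COP" by (simp add: face_by_signs_def)
    then have sym: "D \<in> sym_mats" by (simp add: COP_def)
    have "0 \<le> D \<bullet> V" if V: "V \<in> P_star I \<tau> L" for V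
    proof -
      obtain l where "V = (\<Sum>i\<in>I. outer (\<tau> i) (l i) + outer (l i) (\<tau> i))"
        and l: "\<forall>i\<in>I. \<forall>k\<in>- L i. 0 \<le> l i $ k" using V unfolding P_star_def by blast
      then have "D \<bullet> V = 2 * (\<Sum>i\<in>I. l i \<bullet> (D *v \<tau> i))"
        by (simp only: inner_sum_right inner_outer_pair[OF sym] sum_distrib_left)
      then show ?thesis using multiplier_sum(1)[OF D l I] by simp
    qed
    moreover have "0 \<le> D \<bullet> U" if "U \<in> CP" for U
      using COP that unfolding dual_cone_CP[symmetric] by (simp add: dual_cone_eq)
    ultimately show "D \<in> dual_cone (CP + P_star I \<tau> L)"
      using sym by (auto simp: dual_cone_eq inner_add_right elim!: set_plus_elim)
  qed
  show "dual_cone (CP + P_star I \<tau> L) \<subseteq> face_by_signs I \<tau> L"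
  proof
    fix D assume D: "D \<in> dual_cone (CP + P_star I \<tau> L)"
    then have sym: "D \<in> sym_mats" and nn: "\<And>U V. U \<in> CP \<Longrightarrow> V \<in> P_star I \<tau> L \<Longrightarrow> 0 \<le> D \<bullet> (U + V)"
      by (auto simp: dual_cone_eq)
    have COP: "D \<in> COP"
      unfolding dual_cone_CP[symmetric] using sym nn[OF _ zero_in_P_star] by (simp add: dual_cone_eq)
    have mult: "0 \<le> l \<bullet> (D *v \<tau> i)" if i: "i \<in> I" and l: "\<forall>k\<in>- L i. 0 \<le> l $ k" for i l
    proof -
      \<comment> \<open>Extending \<open>l\<close> by zero to the other indices keeps the
        multipliers admissible and isolates the term of \<open>i\<close>.\<close>
      let ?l = "\<lambda>j. if j = i then l else 0"
      let ?V = "\<Sum>j\<in>I. outer (\<tau> j) (?l j) + outer (?l j) (\<tau> j)"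
      have "?V \<in> P_star I \<tau> L"
        unfolding P_star_def using l by (intro CollectI exI[of _ ?l]) auto
      then have "0 \<le> D \<bullet> ?V" using nn[OF zero_in_CP] by simp
      also have "D \<bullet> ?V = (\<Sum>j\<in>I. 2 * (?l j \<bullet> (D *v \<tau> j)))"
        by (simp only: inner_sum_right inner_outer_pair[OF sym])
      also have "\<dots> = (\<Sum>j\<in>I. if j = i then 2 * (l \<bullet> (D *v \<tau> i)) else 0)"
        by (rule sum.cong) auto
      also have "\<dots> = 2 * (l \<bullet> (D *v \<tau> i))" using i I by simp
      finally show ?thesis by simp
    qed
    \<comment> \<open>The unit vector \<open>axis k 1\<close> is an admissible multiplier for every
      \<open>k\<close>. Its negative, used next, is admissible for \<open>k \<in> L i\<close>, where
      multipliers have free sign; together they give equality there.\<close>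
    have "0 \<le> (D *v \<tau> i) $ k" if "i \<in> I" for i k
      using mult[OF that, of "axis k 1"] by (simp add: inner_axis') (simp add: axis_def)
    moreover have "(D *v \<tau> i) $ k \<le> 0" if "i \<in> I" "k \<in> L i" for i k
      using mult[OF that(1), of "axis k (-1)"] that(2) by (simp add: inner_axis') (force simp: axis_def)
    ultimately show "D \<in> face_by_signs I \<tau> L"
      using COP by (auto simp: face_by_signs_def intro: antisym)
  qed
qed

text \<open>The face is itself the dual of a convex cone of symmetric matrices, so its dual is a
  bidual and therefore a closure.\<close>

lemma dual_face_by_signs:
  assumes "finite I"
  shows "dual_cone (face_by_signs I \<tau> L) = closure (CP + P_star I \<tau> L)"
  unfolding face_by_signs_eq_dual[OF assms]
proof (rule bidual_cone)
  show "CP + P_star I \<tau> L \<subseteq> sym_mats"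
    using CP_sym P_star_sym[of I \<tau> L] subspace_add[OF subspace_sym_mats]
    by (fastforce elim!: set_plus_elim)
  show "convex (CP + P_star I \<tau> L)"
    by (rule convex_set_plus) (auto simp: CP_def convex_P_star)
  show "cone (CP + P_star I \<tau> L)"
    using cone_CP cone_P_star[of I \<tau> L]
    by (fastforce simp: cone_def scaleR_add_right elim!: set_plus_elim intro!: set_plus_intro)
  show "0 \<in> CP + P_star I \<tau> L"
    using set_plus_intro[OF zero_in_CP zero_in_P_star] by simp
qed

section \<open>Induction over the iterations\<close>

text \<open>The base case: pairing with \<open>Y\<close> is a positive combination of form values at
  the points of \<open>I1\<close>, so complementarity at these points describes the first face, with
  the supports as \<open>L1\<close>.\<close>

lemma initial_face:
  assumes step: "initial_step A0 A I1 \<tau> \<gamma> L1" and sym: "A0 \<in> sym_mats" "\<And>j. A j \<in> sym_mats"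
    and Y: "Y = (\<Sum>i\<in>I1. \<gamma> i *\<^sub>R outer (\<tau> i) (\<tau> i))"
  shows "Y \<noteq> 0" "Y \<in> dual_cone COP" "Y \<in> Ker_mat A0 A" "COP \<inter> perp Y = face_by_signs I1 \<tau> L1"
proof -
  have I1: "finite I1" "I1 \<noteq> {}" "\<forall>i\<in>I1. \<tau> i \<in> nonneg_vecs \<and> 0 < \<gamma> i"
    and T: "\<forall>i\<in>I1. \<tau> i \<in> simplex_T"
    and eqs: "\<forall>B \<in> insert A0 (range A). (\<Sum>i\<in>I1. \<gamma> i * (\<tau> i \<bullet> (B *v \<tau> i))) = 0"
    and L1: "\<forall>i\<in>I1. L1 i = P_pos (\<tau> i)"
    using step by (auto simp: initial_step_def simplex_T_def)
  have inner: "D \<bullet> Y = (\<Sum>i\<in>I1. \<gamma> i * (\<tau> i \<bullet> (D *v \<tau> i)))" for D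
    by (simp add: Y inner_sum_right inner_outer)
  have Ysym: "Y \<in> sym_mats"
    unfolding Y by (intro subspace_sum[OF subspace_sym_mats] subspace_scale[OF subspace_sym_mats]
        outer_self_sym)
  \<comment> \<open>This is the trace of \<open>Y\<close>, a positive combination of the squared
    norms of nonzero points.\<close>
  have "0 < mat 1 \<bullet> Y"
    unfolding inner
  proof (rule sum_pos)
    fix i assume i: "i \<in> I1"
    then have "\<tau> i \<noteq> 0" using T by (auto simp: simplex_T_def)
    then show "0 < \<gamma> i * (\<tau> i \<bullet> (mat 1 *v \<tau> i))" using i I1(3) by simp
  qed (use I1 in auto)
  then show "Y \<noteq> 0" by auto
  show "Y \<in> dual_cone COP"
    using Ysym weighted_copositive_sum(1)[OF _ I1(1,3)]
    by (auto simp: dual_cone_eq inner inner_commute[of Y])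
  show "Y \<in> Ker_mat A0 A"
    using Ysym eqs sym by (auto simp: Ker_mat_def mat_inner_eq_inner inner)
  show "COP \<inter> perp Y = face_by_signs I1 \<tau> L1"
  proof -
    have "D \<in> perp Y \<longleftrightarrow> (\<forall>i\<in>I1. (\<forall>k\<in>L1 i. (D *v \<tau> i) $ k = 0) \<and>
        (\<forall>k\<in>- L1 i. 0 \<le> (D *v \<tau> i) $ k))" if "D \<in> COP" for D
      using weighted_copositive_sum(2)[OF that I1(1,3)] L1 that
      by (auto simp: perp_def COP_def mat_inner_eq_inner inner)
    then show ?thesis by (auto simp: face_by_signs_def)
  qed
qed

text \<open>The induction step: on the current face the pairing with \<open>Y\<close> splits into a
  part from the new points and a part from the multipliers, both nonnegative. Orthogonality makes
  both vanish. The first then yields the conditions at the points of \<open>dI\<close>, the second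
  the enlargement of \<open>L\<close> on \<open>I\<close>.\<close>

lemma next_face:
  assumes step: "iteration_step A0 A \<tau> \<gamma> I L dI lam I' L'" and I: "finite I"
    and sym: "A0 \<in> sym_mats" "\<And>j. A j \<in> sym_mats"
    and Y: "Y = (\<Sum>i\<in>dI. \<gamma> i *\<^sub>R outer (\<tau> i) (\<tau> i)) +
      (\<Sum>i\<in>I. outer (\<tau> i) (lam i) + outer (lam i) (\<tau> i))"
  shows "Y \<in> dual_cone (face_by_signs I \<tau> L)" "Y \<in> Ker_mat A0 A"
    "face_by_signs I \<tau> L \<inter> perp Y = face_by_signs I' \<tau> L'"
proof -
  have dI: "finite dI" "\<forall>i\<in>dI. \<tau> i \<in> nonneg_vecs \<and> 0 < \<gamma> i"
    and eqs: "\<forall>B \<in> insert A0 (range A). (\<Sum>i\<in>dI. \<gamma> i * (\<tau> i \<bullet> (B *v \<tau> i))) +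
        2 * (\<Sum>i\<in>I. lam i \<bullet> (B *v \<tau> i)) = 0"
    and lam: "\<forall>i\<in>I. \<forall>k\<in>- L i. 0 \<le> lam i $ k"
    and L': "\<forall>i\<in>I. L' i = L i \<union> {k \<in> - L i. 0 < lam i $ k}" "\<forall>i\<in>dI. L' i = P_pos (\<tau> i)"
    and I': "I' = I \<union> dI"
    using step by (auto simp: iteration_step_def Omega_def simplex_T_def)
  have inner: "D \<bullet> Y = (\<Sum>i\<in>dI. \<gamma> i * (\<tau> i \<bullet> (D *v \<tau> i))) + 2 * (\<Sum>i\<in>I. lam i \<bullet> (D *v \<tau> i))"
    if "D \<in> sym_mats" for D
    unfolding Y by (rule inner_outer_sum[OF that])
  have Ysym: "Y \<in> sym_mats" unfolding Y by (rule sym_outer_sum)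
  have COP: "D \<in> COP" "D \<in> sym_mats" if "D \<in> face_by_signs I \<tau> L" for D
    using that by (auto simp: face_by_signs_def COP_def)
  have nn: "0 \<le> (\<Sum>i\<in>dI. \<gamma> i * (\<tau> i \<bullet> (D *v \<tau> i)))" "0 \<le> (\<Sum>i\<in>I. lam i \<bullet> (D *v \<tau> i))"
    if "D \<in> face_by_signs I \<tau> L" for D
    using weighted_copositive_sum(1)[OF COP(1)[OF that] dI] multiplier_sum(1)[OF that lam I] by auto
  show "Y \<in> dual_cone (face_by_signs I \<tau> L)"
    using Ysym nn COP(2) by (auto simp: dual_cone_eq inner inner_commute[of Y])
  show "Y \<in> Ker_mat A0 A"
    using Ysym eqs sym by (auto simp: Ker_mat_def mat_inner_eq_inner inner)
  have perp_iff: "D \<in> perp Y \<longleftrightarrow>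
      (\<forall>i\<in>dI. (\<forall>k\<in>L' i. (D *v \<tau> i) $ k = 0) \<and> (\<forall>k\<in>- L' i. 0 \<le> (D *v \<tau> i) $ k)) \<and>
      (\<forall>i\<in>I. \<forall>k\<in>- L i. 0 < lam i $ k \<longrightarrow> (D *v \<tau> i) $ k = 0)"
    if D: "D \<in> face_by_signs I \<tau> L" for D
  proof -
    have "D \<in> perp Y \<longleftrightarrow> (\<Sum>i\<in>dI. \<gamma> i * (\<tau> i \<bullet> (D *v \<tau> i))) = 0 \<and>
        (\<Sum>i\<in>I. lam i \<bullet> (D *v \<tau> i)) = 0"
      using COP(2)[OF D] nn[OF D] by (auto simp: perp_def mat_inner_eq_inner inner)
    then show ?thesis
      using weighted_copositive_sum(2)[OF COP(1)[OF D] dI] multiplier_sum(2)[OF D lam I] L'(2)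
      by simp
  qed
  show "face_by_signs I \<tau> L \<inter> perp Y = face_by_signs I' \<tau> L'"
  proof (intro equalityI subsetI)
    fix D assume "D \<in> face_by_signs I \<tau> L \<inter> perp Y"
    then show "D \<in> face_by_signs I' \<tau> L'"
      using perp_iff[of D] L'(1) unfolding face_by_signs_def I' by blast
  next
    fix D assume D: "D \<in> face_by_signs I' \<tau> L'"
    \<comment> \<open>Passing from \<open>L' i\<close> back to \<open>L i\<close> weakens the
      conditions: an index added to \<open>L i\<close> carries an equality, which gives both the old
      inequality and the vanishing needed for orthogonality.\<close>
    have old: "(\<forall>k\<in>L i. (D *v \<tau> i) $ k = 0) \<and> (\<forall>k\<in>- L i. 0 \<le> (D *v \<tau> i) $ k) \<and>
        (\<forall>k\<in>- L i. 0 < lam i $ k \<longrightarrow> (D *v \<tau> i) $ k = 0)" if i: "i \<in> I" for i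
    proof -
      have "\<forall>k\<in>L' i. (D *v \<tau> i) $ k = 0" "\<forall>k\<in>- L' i. 0 \<le> (D *v \<tau> i) $ k"
        using D i by (auto simp: face_by_signs_def I')
      moreover have "L' i = L i \<union> {k \<in> - L i. 0 < lam i $ k}" using L'(1) i by blast
      ultimately show ?thesis by (metis (no_types, lifting) Compl_iff Un_iff mem_Collect_eq order_refl)
    qed
    have face: "D \<in> face_by_signs I \<tau> L" using D old unfolding face_by_signs_def by blast
    moreover have "D \<in> perp Y"
      using D old unfolding perp_iff[OF face] unfolding face_by_signs_def I' by blast
    ultimately show "D \<in> face_by_signs I \<tau> L \<inter> perp Y" by simp
  qed
qed

theorem mainTheorem2:
  fixes A0 :: "real^'p^'p"
    and A :: "'n::finite \<Rightarrow> real^'p^'p"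
    and ms :: nat
    and I dI :: "nat \<Rightarrow> 'i set"
    and \<tau> :: "'i \<Rightarrow> real^'p"
    and \<gamma> :: "'i \<Rightarrow> real"
    and lam :: "nat \<Rightarrow> 'i \<Rightarrow> real^'p"
    and L :: "nat \<Rightarrow> 'i \<Rightarrow> 'p set"
    and Y :: "nat \<Rightarrow> real^'p^'p"
    and F :: "nat \<Rightarrow> (real^'p^'p) set"
  assumes "CARD('p) > 1"
    and "A0 \<in> sym_mats"
    and "\<And>j. A j \<in> sym_mats"
    and "{x :: real^'n. lin_mat A0 A x \<in> COP} \<noteq> {}"
    and "REG_LCoP_run A0 A ms I dI \<tau> \<gamma> lam L"
    and "ms > 0"
  defines "Y \<equiv> Y_mat I dI \<tau> \<gamma> lam"
    and "F \<equiv> face_seq Y"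
  shows "Y 1 \<noteq> 0 \<and>
    (\<forall>m\<in>{1..ms}.
       Y m \<in> dual_cone (F (m - 1)) \<and>
       Y m \<in> Ker_mat A0 A \<and>
       F m = {D \<in> COP. \<forall>i\<in>I m.
                (\<forall>k\<in>L m i. axis k 1 \<bullet> (D *v \<tau> i) = 0) \<and>
                (\<forall>k\<in>- L m i. 0 \<le> axis k 1 \<bullet> (D *v \<tau> i))} \<and>
       dual_cone (F m) = closure (CP + P_star (I m) \<tau> (L m)))"
proof -
  have init: "initial_step A0 A (I 1) \<tau> \<gamma> (L 1)"
    and iter: "\<And>m. 1 \<le> m \<Longrightarrow> m < ms \<Longrightarrow>
      iteration_step A0 A \<tau> \<gamma> (I m) (L m) (dI m) (lam m) (I (m + 1)) (L (m + 1))"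
    using assms(5,6) by (auto simp: REG_LCoP_run_def)
  note start = initial_face[OF init assms(2,3), of "Y 1"]
  have Y1: "Y 1 = (\<Sum>i\<in>I 1. \<gamma> i *\<^sub>R outer (\<tau> i) (\<tau> i))" by (simp add: Y_def)
  \<comment> \<open>The matrix with index \<open>Suc m\<close> is built from the choices of
    iteration \<open>m\<close>. The bound on \<open>m\<close> excludes the first matrix, which has
    its own clause.\<close>
  have YS: "Y (Suc m) = (\<Sum>i\<in>dI m. \<gamma> i *\<^sub>R outer (\<tau> i) (\<tau> i)) +
      (\<Sum>i\<in>I m. outer (\<tau> i) (lam m i) + outer (lam m i) (\<tau> i))" if "1 \<le> m" for m
    using that by (cases m) (auto simp: Y_def)
  \<comment> \<open>Finiteness of \<open>I m\<close> is carried along because the sums over it are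
    split term by term in the induction step and in the duality result.\<close>
  have main: "finite (I m) \<and> Y m \<in> dual_cone (F (m - 1)) \<and> Y m \<in> Ker_mat A0 A \<and>
      F m = face_by_signs (I m) \<tau> (L m)" if "1 \<le> m" "m \<le> ms" for m
    using that
  proof (induction m rule: nat_induct_at_least)
    case base
    show ?case
      using start[OF Y1] init by (simp add: F_def initial_step_def)
  next
    case (Suc m)
    then have IH: "finite (I m)" "F m = face_by_signs (I m) \<tau> (L m)" by auto
    have step: "iteration_step A0 A \<tau> \<gamma> (I m) (L m) (dI m) (lam m) (I (Suc m)) (L (Suc m))"
      using iter[of m] Suc.hyps Suc.prems by simp
    have "finite (I (Suc m))" using step IH(1) by (auto simp: iteration_step_def)
    moreover have "F (Suc m) = F m \<inter> perp (Y (Suc m))" by (simp add: F_def)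
    ultimately show ?case
      using next_face[OF step IH(1) assms(2,3) YS[OF Suc.hyps]] IH(2) by simp
  qed
  show ?thesis
  proof (intro conjI ballI)
    show "Y 1 \<noteq> 0" by (rule start(1)[OF Y1])
    fix m assume "m \<in> {1..ms}"
    then have m: "finite (I m)" "Y m \<in> dual_cone (F (m - 1))" "Y m \<in> Ker_mat A0 A"
      "F m = face_by_signs (I m) \<tau> (L m)" using main[of m] by auto
    show "Y m \<in> dual_cone (F (m - 1))" "Y m \<in> Ker_mat A0 A" by (fact m)+
    show "F m = {D \<in> COP. \<forall>i\<in>I m.
                (\<forall>k\<in>L m i. axis k 1 \<bullet> (D *v \<tau> i) = 0) \<and>
                (\<forall>k\<in>- L m i. 0 \<le> axis k 1 \<bullet> (D *v \<tau> i))}"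
      by (simp add: m(4) face_by_signs_def inner_axis')
    show "dual_cone (F m) = closure (CP + P_star (I m) \<tau> (L m))"
      using dual_face_by_signs[OF m(1)] by (simp add: m(4))
  qed
qed

end
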